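(* Let $(\mathbb{X},\mathbb{0},\mathbb{1},\oplus,\otimes)$ be a linearly ordered radicable idempotent semifield. Let $p_1,\ldots,p_M\in\mathbb{Q}$, and let $a_1,\ldots,a_M,g,h\in\mathbb{X}$ be such that $a_i\neq\mathbb{0}$ for all $i=1,\ldots,M$, $h\neq\mathbb{0}$ and $g\leq h$. Consider the problem of finding nonzero $x\in\mathbb{X}$ that give $$\min_{x}\ \bigoplus_{i=1}^{M}a_i x^{p_i}\quad\text{s.t.}\quad g\leq x\leq h .$$ The minimum value of the objective function in this problem is equal to $$\mu=\bigoplus_{\substack{1\leq i,k\leq M\\ p_i<0,\ p_k>0}}a_i^{-\frac{p_k}{p_i-p_k}}a_k^{\frac{p_i}{p_i-p_k}}\ \oplus\ \bigoplus_{1\leq i\leq M}(h^{-p_i}\oplus g^{-p_i})^{-1}a_i ,$$ whereas all solutions are given by the condition $$\bigoplus_{\substack{1\leq i\leq M\\ p_i<0}}\mu^{1/p_i}a_i^{-1/p_i}\oplus g\ \leq\ x\ \leq\ \left(\bigoplus_{\substack{1\leq i\leq M\\ p_i>0}}\mu^{-1/p_i}a_i^{1/p_i}\oplus h^{-1}\right)^{-1},$$ where empty sums are interpreted as $\mathbb{0}$.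
   Context: An idempotent semifield $(\mathbb{X},\mathbb{0},\mathbb{1},\oplus,\otimes)$ is a nonempty set $\mathbb{X}$ with addition $\oplus$, multiplication $\otimes$ and distinct elements $\mathbb{0},\mathbb{1}$ such that $(\mathbb{X},\mathbb{0},\oplus)$ is a commutative monoid with $x\oplus x=x$ for all $x$, $(\mathbb{X}\setminus\{\mathbb{0}\},\mathbb{1},\otimes)$ is an Abelian group, and $\otimes$ distributes over $\oplus$ (it is a semiring with idempotent addition and invertible multiplication). The sign $\otimes$ is omitted in formulas. The order is defined by: $x\leq y$ if and only if $x\oplus y=y$, so $x\geq\mathbb{0}$ for all $x$; the minimum is understood with respect to this order. "Linearly ordered" means that this partial order is a linear order. "Radicable" means that for each $a\in\mathbb{X}$ and each integer $n>0$ the equation $x^n=a$ has a unique solution $x\in\mathbb{X}$, so that rational powers are well defined. All inverses and powers of elements of $\mathbb{X}$ are taken in the sense of the semifield multiplication: for nonzero $x$ and integers $m$, $n>0$, the power $x^{m/n}$ is the unique $y$ with $y^n=x^m$; $x^0=\mathbb{1}$ for nonzero $x$; and $\mathbb{0}^n=\mathbb{0}$ for positive integers $n$. The exponents themselves are ordinary rational numbers. Under the condition $g\leq h$, the expression $(h^{-p}\oplus g^{-p})^{-1}$ equals $h^{p}$ if $p<0$, $\mathbb{1}$ if $p=0$, and $g^{p}$ if $p>0$.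
   Formalization: The case M ≥ 1, g = 0 with all p_i > 0 is excluded: there the formula gives μ = 0, which no nonzero x attains, and the powers μ^{-1/p_i} are undefined. *)

theory Defs
  imports Complex_Main
begin

text \<open>
  The carrier of the semifield is a type; semifield addition, multiplication, zero and one are
  \<open>+\<close>, \<open>*\<close>, \<open>0\<close>, \<open>1\<close>. The order \<open>\<le>\<close> is the one induced by the idempotent addition.
  As in the library's division rings, \<open>inverse\<close> is made total by \<open>inverse 0 = 0\<close>.
\<close>

class idempotent_semifield = comm_semiring_1 + inverse + order +
  assumes add_idem: "x + x = x"
    and le_iff_add_eq: "x \<le> y \<longleftrightarrow> x + y = y"
    and semifield_left_inverse: "x \<noteq> 0 \<Longrightarrow> inverse x * x = 1"
    and semifield_inverse_zero: "inverse 0 = 0"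
    and semifield_divide_inverse: "x / y = x * inverse y"

class linordered_radicable_semifield = idempotent_semifield + linorder +
  assumes radicable: "0 < n \<Longrightarrow> \<exists>!x. x ^ n = a"

text \<open>
  For \<open>q = m / n\<close> in lowest terms, \<open>x powq q\<close> is the unique \<open>y\<close> with \<open>y ^ n = x powi m\<close>; by
  \<open>powq_eq_iff\<close> below, any representation of \<open>q\<close> with positive denominator may be used.
  As values for \<open>x = 0\<close> this gives \<open>0 powq q = 0\<close> for \<open>q > 0\<close> and, as conventions for expressions
  with no mathematical meaning, \<open>0 powq 0 = 1\<close> and \<open>0 powq q = 0\<close> for \<open>q < 0\<close>.
\<close>

definition powq :: "'a::linordered_radicable_semifield \<Rightarrow> rat \<Rightarrow> 'a" (infixr "powq" 80) where
  "x powq q = (THE y. y ^ nat (snd (quotient_of q)) = x powi fst (quotient_of q))"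

text \<open>
  The expression \<open>(h\<^sup>-\<^sup>p + g\<^sup>-\<^sup>p)\<^sup>-\<^sup>1\<close> for \<open>g \<le> h\<close>. For \<open>g = 0\<close> and \<open>p > 0\<close> the power \<open>g\<^sup>-\<^sup>p\<close> is undefined
  (intuitively infinite), and the expression stands for \<open>g\<^sup>p = 0\<close>; the case distinction
  prevents the totalised \<open>0 powq (- p) = 0\<close> from giving the wrong value \<open>h\<^sup>p\<close>.
\<close>

definition bound_powq ::
    "'a::linordered_radicable_semifield \<Rightarrow> 'a \<Rightarrow> rat \<Rightarrow> 'a" where
  "bound_powq g h p =
     (if g = 0 \<and> 0 < p then g powq p else inverse (h powq (- p) + g powq (- p)))"

context idempotent_semifield
begin

lemma semifield_right_inverse: "x \<noteq> 0 \<Longrightarrow> x * inverse x = 1"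
  using semifield_left_inverse by (simp add: mult.commute)

lemma semifield_inverse_nonzero: "x \<noteq> 0 \<Longrightarrow> inverse x \<noteq> 0"
  using semifield_left_inverse[of x] by (metis mult_zero_left zero_neq_one)

lemma semifield_inverse_unique:
  assumes "x * y = 1" shows "inverse x = y"
proof -
  have "x \<noteq> 0" using assms by auto
  then have "inverse x = inverse x * (x * y)" "inverse x * x = 1"
    using assms by (simp_all add: semifield_left_inverse)
  then show ?thesis by (metis mult.assoc mult_1_left)
qed

lemma semifield_mult_mono: "a \<le> b \<Longrightarrow> c \<le> d \<Longrightarrow> a * c \<le> b * d"
proof -
  assume "a \<le> b" "c \<le> d"
  then have "a * c \<le> b * c" "b * c \<le> b * d"
    by (simp_all add: le_iff_add_eq flip: distrib_left distrib_right)
  then show ?thesis by (rule order_trans)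
qed

end

lemma semifield_inverse_power:
  fixes x :: "'a::idempotent_semifield"
  assumes "x \<noteq> 0" shows "inverse x ^ n = inverse (x ^ n)"
proof -
  have "x ^ n * inverse x ^ n = 1"
    using semifield_right_inverse[OF assms] by (simp flip: power_mult_distrib)
  then show ?thesis by (simp add: semifield_inverse_unique)
qed

lemma semifield_power_mono:
  fixes x y :: "'a::idempotent_semifield"
  shows "x \<le> y \<Longrightarrow> x ^ n \<le> y ^ n"
  by (induction n) (auto intro: semifield_mult_mono)

lemma radicable_power_cancel:
  fixes x y :: "'a::linordered_radicable_semifield"
  shows "0 < n \<Longrightarrow> x ^ n = y ^ n \<Longrightarrow> x = y"
  using radicable[of n "y ^ n"] by blast

lemma radicable_power_le_cancel:
  fixes x y :: "'a::linordered_radicable_semifield"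
  assumes "0 < n" "x ^ n \<le> y ^ n"
  shows "x \<le> y"
proof (rule ccontr)
  assume "\<not> x \<le> y"
  then have "y \<le> x" "x \<noteq> y" by auto
  with semifield_power_mono[of y x n] assms have "x ^ n = y ^ n" by auto
  with \<open>x \<noteq> y\<close> radicable_power_cancel[OF assms(1)] show False by blast
qed

lemma semifield_powi_mult_nat:
  fixes x :: "'a::idempotent_semifield"
  shows "(x powi m) ^ k = x powi (m * int k)"
proof (cases "k = 0 \<or> 0 \<le> m")
  case True
  then show ?thesis by (auto simp: power_int_def nat_mult_distrib power_mult)
next
  case False
  then have "nat (- (m * int k)) = nat (- m) * k"
    by (metis mult_minus_left nat_int nat_mult_distrib neg_0_le_iff_le nle_le)
  moreover have "\<not> 0 \<le> m * int k" using False by (auto simp: zero_le_mult_iff)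
  ultimately show ?thesis using False by (simp add: power_int_def power_mult)
qed

lemma powq_power:
  fixes x :: "'a::linordered_radicable_semifield"
  shows "(x powq q) ^ nat (snd (quotient_of q)) = x powi fst (quotient_of q)"
  unfolding powq_def by (rule theI') (simp add: radicable quotient_of_denom_pos')

lemma powq_eq_iff:
  fixes x y :: "'a::linordered_radicable_semifield"
  assumes "0 < n"
  shows "x powq (of_int m / of_nat n) = y \<longleftrightarrow> y ^ n = x powi m"
proof -
  define q :: rat where "q = of_int m / of_nat n"
  obtain m' n' where mn: "quotient_of q = (m', n')" by force
  have n': "0 < n'" using quotient_of_denom_pos[OF mn] .
  have "of_int (m * n') = (of_int (m' * int n) :: rat)"
    using quotient_of_div[OF mn] assms n' by (simp add: q_def field_simps)
  then have eq: "m * n' = m' * int n" by (simp only: of_int_eq_iff)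
  have "((x powq q) ^ n) ^ nat n' = ((x powq q) ^ nat n') ^ n"
    by (simp flip: power_mult add: mult.commute)
  also have "\<dots> = (x powi m') ^ n" using powq_power[of x q] mn by simp
  also have "\<dots> = (x powi m) ^ nat n'" using n' eq by (simp add: semifield_powi_mult_nat)
  finally have "(x powq q) ^ n = x powi m"
    by (rule radicable_power_cancel[rotated]) (use n' in simp)
  then show ?thesis
    using radicable_power_cancel[OF assms] unfolding q_def by metis
qed

lemma powq_0_right [simp]: "x powq 0 = 1"
  using powq_eq_iff[of 1 x 0 1] by simp

lemma rat_cases_nat_denom:
  fixes q :: rat
  obtains m n where "0 < n" "q = of_int m / of_nat n"
  using quotient_of_div[of q "fst (quotient_of q)" "snd (quotient_of q)"]
    quotient_of_denom_pos'[of q] that[of "nat (snd (quotient_of q))" "fst (quotient_of q)"]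
  by simp

lemma powq_0_left:
  assumes "0 < q" shows "0 powq q = (0::'a::linordered_radicable_semifield)"
proof -
  obtain m n where q: "0 < n" "q = of_int m / of_nat n" by (rule rat_cases_nat_denom)
  then have "0 < m" using assms by (simp add: zero_less_divide_iff)
  then show ?thesis
    using powq_eq_iff[OF q(1), of 0 m "0::'a"] q by (simp add: power_int_def power_0_left)
qed

lemma powq_uminus:
  fixes x :: "'a::linordered_radicable_semifield"
  assumes "x \<noteq> 0" shows "x powq (- q) = inverse (x powq q)"
proof -
  obtain m n where q: "0 < n" "q = of_int m / of_nat n" by (rule rat_cases_nat_denom)
  let ?y = "x powq q"
  have y: "?y ^ n = x powi m" using powq_eq_iff[OF q(1)] q(2) by blast
  have inv_inv: "inverse (inverse z) = z" if "z \<noteq> 0" for z :: 'a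
    by (intro semifield_inverse_unique semifield_left_inverse that)
  have nz: "z ^ k \<noteq> 0" if "z \<noteq> 0" for z :: 'a and k
    using semifield_right_inverse[OF that] 
    by (metis mult_zero_left power_mult_distrib power_one zero_neq_one)
  have "x powi m \<noteq> 0"
    using assms by (simp add: power_int_def nz semifield_inverse_nonzero)
  then have "?y \<noteq> 0" using y q(1) by (auto simp: power_0_left)
  then have "inverse ?y ^ n = inverse (x powi m)" by (simp add: semifield_inverse_power y)
  also have "\<dots> = x powi (- m)"
    using assms nz
    by (cases "m = 0") (auto simp: power_int_def semifield_inverse_power inv_inv
        intro: semifield_inverse_unique)
  finally have "x powq (of_int (- m) / of_nat n) = inverse ?y"
    using powq_eq_iff[OF q(1)] by blast
  then show ?thesis using q(2) by simp
qed

lemma powq_mono: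
  fixes x y :: "'a::linordered_radicable_semifield"
  assumes "x \<le> y" "0 \<le> q" shows "x powq q \<le> y powq q"
proof -
  obtain m n where q: "0 < n" "q = of_int m / of_nat n" by (rule rat_cases_nat_denom)
  then have "0 \<le> m" using assms(2) by (simp add: zero_le_divide_iff)
  then have "(x powq q) ^ n \<le> (y powq q) ^ n"
    using powq_eq_iff[OF q(1), of _ m] q(2) semifield_power_mono[OF assms(1)]
    by (metis power_int_def)
  then show ?thesis using radicable_power_le_cancel q(1) by blast
qed

lemma powq_nonzero:
  fixes x :: "'a::linordered_radicable_semifield"
  assumes "x \<noteq> 0" shows "x powq q \<noteq> 0"
proof
  assume "x powq q = 0"
  moreover obtain m n where q: "0 < n" "q = of_int m / of_nat n" by (rule rat_cases_nat_denom)
  ultimately have "x powi m = 0"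
    using powq_eq_iff[OF q(1), of x m 0] by (simp add: power_0_left)
  moreover have nz: "z ^ k \<noteq> 0" if "z \<noteq> 0" for z :: 'a and k
    using semifield_right_inverse[OF that] 
    by (metis mult_zero_left power_mult_distrib power_one zero_neq_one)
  ultimately show False
    using assms semifield_inverse_nonzero by (auto simp: power_int_def split: if_splits)
qed

lemma bound_powq_eq:
  fixes g h :: "'a::linordered_radicable_semifield"
  assumes "h \<noteq> 0" "g \<le> h"
  shows "bound_powq g h p = (if p < 0 then h powq p else if p = 0 then 1 else g powq p)"
proof -
  have inv_inv: "inverse (inverse z) = z" if "z \<noteq> 0" for z :: 'a
    by (intro semifield_inverse_unique semifield_left_inverse that)
  consider "p < 0" | "p = 0" | "0 < p" "g = 0" | "0 < p" "g \<noteq> 0" by fastforce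
  then show ?thesis
  proof cases
    case 1
    then have "g powq (- p) + h powq (- p) = h powq (- p)"
      using powq_mono[OF assms(2), of "- p"] by (simp add: le_iff_add_eq)
    then show ?thesis
      using 1 powq_uminus[OF assms(1), of "- p"] by (simp add: bound_powq_def add.commute)
  next
    case 2
    then show ?thesis by (simp add: bound_powq_def add_idem semifield_inverse_unique)
  next
    case 3
    then show ?thesis by (simp add: bound_powq_def)
  next
    case 4
    have "g powq p \<le> h powq p" using powq_mono[OF assms(2), of p] 4 by simp
    from semifield_mult_mono[OF order_refl this, of "inverse (g powq p) * inverse (h powq p)"]
    have "inverse (h powq p) \<le> inverse (g powq p)"
      using semifield_left_inverse[OF powq_nonzero[OF 4(2)], of p]
        semifield_left_inverse[OF powq_nonzero[OF assms(1)], of p]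
      by (metis mult.assoc mult.commute mult_1_right)
    then have "h powq (- p) + g powq (- p) = inverse (g powq p)"
      using 4 assms by (simp add: powq_uminus le_iff_add_eq)
    then show ?thesis
      using 4 powq_nonzero[OF 4(2)] by (simp add: bound_powq_def inv_inv)
  qed
qed

end

theory Submission
  imports Defs
begin

text \<open>
  For nonzero \<open>x\<close> every single inequality \<open>a\<^sub>i x\<^bsup>p\<^sub>i\<^esup> \<le> \<mu>\<close> can be solved for \<open>x\<close>, and solving all of
  them yields the asserted interval. Each term of \<open>\<mu>\<close> is a lower bound of the objective: in the
  mixed terms the exponents of \<open>a\<^sub>i\<close> and \<open>a\<^sub>k\<close> are the weights of the convex combination
  of \<open>p\<^sub>i\<close> and \<open>p\<^sub>k\<close> that vanishes, so that the powers of \<open>x\<close> cancel. The interval is nonempty because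
  it contains its upper end, where either \<open>x = h\<close> or \<open>a\<^sub>k x\<^bsup>p\<^sub>k\<^esup> = \<mu>\<close> for some \<open>k\<close>.
\<close>

section \<open>Order and inverses in idempotent semifields\<close>

lemma semifield_zero_le [simp]: "0 \<le> (x::'a::idempotent_semifield)"
  by (simp add: le_iff_add_eq)

text \<open>Idempotent addition is the join of the order that it induces.\<close>

lemma semifield_add_le_iff:
  fixes x y z :: "'a::idempotent_semifield"
  shows "x + y \<le> z \<longleftrightarrow> x \<le> z \<and> y \<le> z"
proof
  assume "x + y \<le> z"
  then have z: "x + y + z = z" by (simp add: le_iff_add_eq)
  have "x + z = z" by (metis z add.assoc add_idem)
  moreover have "y + z = z" by (metis z add.assoc add.commute add_idem)
  ultimately show "x \<le> z \<and> y \<le> z" by (simp add: le_iff_add_eq)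
qed (simp add: le_iff_add_eq add.assoc)

lemma semifield_sum_le_iff:
  fixes f :: "'b \<Rightarrow> 'a::idempotent_semifield"
  assumes "finite A"
  shows "sum f A \<le> z \<longleftrightarrow> (\<forall>i\<in>A. f i \<le> z)"
  using assms by (induction A) (auto simp: semifield_add_le_iff)

text \<open>In a linear order the join of two elements is one of them. The alternative 0 covers the
  empty sum.\<close>

lemma semifield_sum_attained:
  fixes f :: "'b \<Rightarrow> 'a::linordered_radicable_semifield"
  assumes "finite A"
  shows "sum f A = 0 \<or> (\<exists>i\<in>A. sum f A = f i)"
  using assms
proof (induction A)
  case (insert i A)
  have "f i + sum f A = sum f A \<or> f i + sum f A = f i"
    by (metis le_iff_add_eq linear add.commute)
  with insert show ?case by auto
qed simp

lemma semifield_mult_eq_0_iff: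
  fixes x y :: "'a::idempotent_semifield"
  shows "x * y = 0 \<longleftrightarrow> x = 0 \<or> y = 0"
  by (metis mult_zero_left mult_zero_right mult.assoc mult_1_left semifield_left_inverse)

lemma semifield_inverse_inverse [simp]:
  fixes x :: "'a::idempotent_semifield"
  shows "inverse (inverse x) = x"
  by (metis semifield_inverse_unique semifield_inverse_zero semifield_left_inverse)

lemma semifield_inverse_mult:
  fixes x y :: "'a::idempotent_semifield"
  shows "inverse (x * y) = inverse x * inverse y"
proof (cases "x = 0 \<or> y = 0")
  case False
  have "(x * y) * (inverse x * inverse y) = (x * inverse x) * (y * inverse y)"
    by (simp add: ac_simps)
  then show ?thesis using False
    by (intro semifield_inverse_unique) (simp add: semifield_right_inverse)
qed (auto simp: semifield_inverse_zero)

lemma semifield_mult_le_cancel: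
  fixes x y z :: "'a::idempotent_semifield"
  assumes "z \<noteq> 0"
  shows "x * z \<le> y * z \<longleftrightarrow> x \<le> y"
proof
  assume "x * z \<le> y * z"
  from semifield_mult_mono[OF this order_refl, of "inverse z"]
  show "x \<le> y" using assms by (simp add: mult.assoc semifield_right_inverse)
qed (simp add: semifield_mult_mono)

lemma semifield_mult_inverse_le_iff:
  fixes x y z :: "'a::idempotent_semifield"
  assumes "y \<noteq> 0"
  shows "x * inverse y \<le> z \<longleftrightarrow> x \<le> z * y"
  using semifield_mult_le_cancel[OF assms, of "x * inverse y" z] assms
  by (simp add: mult.assoc semifield_left_inverse)

lemma semifield_le_inverse_iff:
  fixes x y :: "'a::idempotent_semifield"
  assumes "x \<noteq> 0" "y \<noteq> 0"
  shows "x \<le> inverse y \<longleftrightarrow> y \<le> inverse x"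
  using semifield_mult_inverse_le_iff[of "inverse y" x 1]
    semifield_mult_inverse_le_iff[of "inverse x" y 1] assms
  by (simp add: semifield_inverse_nonzero mult.commute)

lemma semifield_inverse_le_inverse_iff:
  fixes x y :: "'a::idempotent_semifield"
  assumes "x \<noteq> 0" "y \<noteq> 0"
  shows "inverse x \<le> inverse y \<longleftrightarrow> y \<le> x"
  using semifield_le_inverse_iff[of "inverse x" y] assms
  by (simp add: semifield_inverse_nonzero)

section \<open>Laws of rational powers\<close>

text \<open>Writing integer exponents as differences of naturals spares the addition law below a
  case distinction on signs.\<close>

lemma semifield_powi_diff:
  fixes x :: "'a::idempotent_semifield"
  assumes "x \<noteq> 0"
  shows "x powi (int i - int j) = x ^ i * inverse x ^ j"
proof -
  have unit: "x ^ k * inverse x ^ k = 1" for k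
    using semifield_right_inverse[OF assms] by (simp flip: power_mult_distrib)
  show ?thesis
  proof (cases "j \<le> i")
    case True
    then obtain k where k: "i = j + k" by (auto simp: le_iff_add)
    have "x ^ i * inverse x ^ j = x ^ k * (x ^ j * inverse x ^ j)"
      by (simp add: k power_add ac_simps)
    then show ?thesis by (simp add: unit k power_int_def)
  next
    case False
    then obtain k where k: "j = i + k" by (metis le_iff_add linear)
    have "x ^ i * inverse x ^ j = inverse x ^ k * (x ^ i * inverse x ^ i)"
      by (simp add: k power_add ac_simps)
    then show ?thesis using False by (simp add: unit k power_int_def)
  qed
qed

lemma semifield_powi_add:
  fixes x :: "'a::idempotent_semifield"
  assumes "x \<noteq> 0"
  shows "x powi (m + n) = x powi m * x powi n"
proof -
  obtain i j k l where m: "m = int i - int j" and n: "n = int k - int l"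
    by (metis int_diff_cases)
  have "m + n = int (i + k) - int (j + l)" by (simp add: m n)
  then have "x powi (m + n) = x ^ (i + k) * inverse x ^ (j + l)"
    by (simp only: semifield_powi_diff[OF assms])
  then show ?thesis
    by (simp only: m n semifield_powi_diff[OF assms] power_add ac_simps)
qed

lemma semifield_powi_mult_distrib:
  fixes x y :: "'a::idempotent_semifield"
  shows "(x * y) powi m = x powi m * y powi m"
  by (simp add: power_int_def power_mult_distrib semifield_inverse_mult)

lemma powq_1_right [simp]: "x powq 1 = x"
  using powq_eq_iff[of 1 x 1 x] by simp

text \<open>Both sides are roots of the same element, of degree the common denominator
  \<open>n * l\<close>, and roots are unique.\<close>

lemma powq_add:
  fixes x :: "'a::linordered_radicable_semifield"
  assumes "x \<noteq> 0"
  shows "x powq (q + r) = x powq q * x powq r"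
proof -
  obtain m n where q: "0 < n" "q = of_int m / of_nat n" by (rule rat_cases_nat_denom)
  obtain k l where r: "0 < l" "r = of_int k / of_nat l" by (rule rat_cases_nat_denom)
  have qn: "(x powq q) ^ n = x powi m" using powq_eq_iff[OF q(1)] q(2) by blast
  have rl: "(x powq r) ^ l = x powi k" using powq_eq_iff[OF r(1)] r(2) by blast
  have sum: "q + r = of_int (m * int l + k * int n) / of_nat (n * l)"
    using q r by (simp add: field_simps)
  have "(x powq q * x powq r) ^ (n * l) = ((x powq q) ^ n) ^ l * ((x powq r) ^ l) ^ n"
    by (simp add: power_mult_distrib ac_simps flip: power_mult)
  also have "\<dots> = x powi (m * int l + k * int n)"
    using assms by (simp add: qn rl semifield_powi_mult_nat semifield_powi_add)
  finally show ?thesis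
    unfolding sum using q(1) r(1) by (subst powq_eq_iff) auto
qed

lemma powq_mult_distrib:
  fixes x y :: "'a::linordered_radicable_semifield"
  shows "(x * y) powq q = x powq q * y powq q"
proof -
  obtain m n where q: "0 < n" "q = of_int m / of_nat n" by (rule rat_cases_nat_denom)
  have "(z powq q) ^ n = z powi m" for z :: 'a using powq_eq_iff[OF q(1)] q(2) by blast
  then have "(x powq q * y powq q) ^ n = (x * y) powi m"
    by (simp add: power_mult_distrib semifield_powi_mult_distrib)
  then show ?thesis using powq_eq_iff[OF q(1)] q(2) by blast
qed

lemma powq_powq:
  fixes x :: "'a::linordered_radicable_semifield"
  assumes "x \<noteq> 0"
  shows "(x powq q) powq r = x powq (q * r)"
proof -
  \<comment> \<open>For \<open>0 \<le> r\<close> the outer numerator is a natural number, so the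
    powers can be interchanged; inversion reduces negative \<open>r\<close> to this case.\<close>
  have nonneg: "(x powq q) powq r = x powq (q * r)" if "0 \<le> r" for r
  proof -
    obtain m n where q: "0 < n" "q = of_int m / of_nat n" by (rule rat_cases_nat_denom)
    obtain k l where r: "0 < l" "r = of_int k / of_nat l" by (rule rat_cases_nat_denom)
    have k: "0 \<le> k" using r that by (simp add: zero_le_divide_iff)
    let ?y = "x powq q"
    have yn: "?y ^ n = x powi m" using powq_eq_iff[OF q(1)] q(2) by blast
    have "(?y powq r) ^ l = ?y powi k" using powq_eq_iff[OF r(1)] r(2) by blast
    then have "(?y powq r) ^ (n * l) = (?y ^ n) ^ nat k"
      using k by (metis power_int_def power_mult mult.commute)
    also have "\<dots> = x powi (m * k)" using k by (simp add: yn semifield_powi_mult_nat)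
    finally have *: "(?y powq r) ^ (n * l) = x powi (m * k)" .
    have "q * r = of_int (m * k) / of_nat (n * l)" using q r by simp
    with * show ?thesis using q(1) r(1) by (metis powq_eq_iff nat_0_less_mult_iff)
  qed
  show ?thesis
  proof (cases "0 \<le> r")
    case False
    with nonneg[of "- r"] show ?thesis
      using powq_uminus[OF powq_nonzero[OF assms], of q "- r"]
        powq_uminus[OF assms, of "- (q * r)"] by simp
  qed (rule nonneg)
qed

lemma powq_le_iff:
  fixes x y :: "'a::linordered_radicable_semifield"
  assumes "0 < q" "x \<noteq> 0" "y \<noteq> 0"
  shows "x powq q \<le> y powq q \<longleftrightarrow> x \<le> y"
proof
  assume "x powq q \<le> y powq q"
  then have "(x powq q) powq (1 / q) \<le> (y powq q) powq (1 / q)"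
    using assms(1) powq_mono[of "x powq q" "y powq q" "1 / q"] by simp
  then show "x \<le> y" using assms by (simp add: powq_powq)
qed (use assms in \<open>simp add: powq_mono\<close>)

lemma powq_antimono:
  fixes x y :: "'a::linordered_radicable_semifield"
  assumes "x \<noteq> 0" "x \<le> y" "q \<le> 0"
  shows "y powq q \<le> x powq q"
proof -
  have y: "y \<noteq> 0" using assms by (auto dest: antisym)
  have "x powq (- q) \<le> y powq (- q)" using assms by (simp add: powq_mono)
  then show ?thesis using assms(1) y
    by (simp add: powq_uminus semifield_inverse_le_inverse_iff powq_nonzero)
qed

section \<open>Power inequalities and the objective\<close>

text \<open>The exponent \<open>- 1 / p\<close> is positive, so raising to it preserves and reflects
  the order, and it turns \<open>x powq p\<close> into \<open>inverse x\<close>. Clearing the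
  inverses isolates \<open>x\<close>.\<close>

lemma mult_powq_le_iff_neg:
  fixes a c x :: "'a::linordered_radicable_semifield"
  assumes "a \<noteq> 0" "c \<noteq> 0" "x \<noteq> 0" "p < 0"
  shows "a * x powq p \<le> c \<longleftrightarrow> c powq (1 / p) * a powq (- 1 / p) \<le> x"
proof -
  let ?s = "- 1 / p"
  have s: "0 < ?s" "p * ?s = - 1" using assms(4) by (auto simp: divide_neg_neg)
  have "a * x powq p \<le> c \<longleftrightarrow> (a * x powq p) powq ?s \<le> c powq ?s"
    using s(1) assms by (subst powq_le_iff) (auto simp: powq_nonzero semifield_mult_eq_0_iff)
  also have "\<dots> \<longleftrightarrow> a powq ?s * inverse x \<le> c powq ?s"
    using assms(3) s(2) by (simp add: powq_mult_distrib powq_powq powq_uminus)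
  also have "\<dots> \<longleftrightarrow> a powq ?s * inverse (c powq ?s) \<le> x"
    using semifield_mult_inverse_le_iff[OF assms(3), of "a powq ?s" "c powq ?s"]
      semifield_mult_inverse_le_iff[OF powq_nonzero[OF assms(2)], of "a powq ?s" ?s x]
    by (metis mult.commute)
  also have "inverse (c powq ?s) = c powq (1 / p)"
    using powq_uminus[OF assms(2), of ?s] by simp
  finally show ?thesis by (simp add: mult.commute)
qed

text \<open>This is the previous case for \<open>inverse x\<close> and \<open>- p\<close>. Bounding
  \<open>inverse x\<close> from below lets several upper bounds on \<open>x\<close> be combined by
  addition.\<close>

lemma mult_powq_le_iff_pos:
  fixes a c x :: "'a::linordered_radicable_semifield"
  assumes "a \<noteq> 0" "c \<noteq> 0" "x \<noteq> 0" "0 < p"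
  shows "a * x powq p \<le> c \<longleftrightarrow> c powq (- 1 / p) * a powq (1 / p) \<le> inverse x"
proof -
  have inv: "inverse x powq (- p) = x powq p"
    using powq_powq[OF assms(3), of "- 1" "- p"] powq_uminus[OF assms(3), of 1] by simp
  show ?thesis
    using mult_powq_le_iff_neg[of a c "inverse x" "- p"] assms
    by (simp add: inv semifield_inverse_nonzero)
qed

text \<open>The boundary case of the preceding inequality, needed at the upper end of the solution
  interval.\<close>

lemma mult_powq_eq_pos:
  fixes a c :: "'a::linordered_radicable_semifield"
  assumes "a \<noteq> 0" "c \<noteq> 0" "0 < p"
    and "inverse x = c powq (- 1 / p) * a powq (1 / p)"
  shows "a * x powq p = c"
proof -
  have "x = inverse (c powq (- 1 / p)) * inverse (a powq (1 / p))"
    using assms(4) by (metis semifield_inverse_inverse semifield_inverse_mult)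
  then have "x = c powq (1 / p) * a powq (- 1 / p)"
    using powq_uminus[OF assms(2), of "- 1 / p"] powq_uminus[OF assms(1), of "1 / p"] by simp
  then have "x powq p = c * inverse a"
    using assms powq_uminus[OF assms(1), of 1] by (simp add: powq_mult_distrib powq_powq)
  then show ?thesis
    using semifield_right_inverse[OF assms(1)] by (metis mult.left_commute mult_1_right)
qed

text \<open>The exponents of \<open>x\<close> add up to \<open>p * s + r * t\<close>. The identity
  serves both to bound the objective from below and to compare the two ends of the interval.\<close>

lemma weighted_powq_cancel:
  fixes a b x :: "'a::linordered_radicable_semifield"
  assumes "x \<noteq> 0" "p * s + r * t = 0"
  shows "(a * x powq p) powq s * (b * x powq r) powq t = a powq s * b powq t"
proof -
  have "(a * x powq p) powq s * (b * x powq r) powq t =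
      a powq s * b powq t * x powq (p * s + r * t)"
    using assms(1) by (simp add: powq_mult_distrib powq_powq powq_add ac_simps)
  then show ?thesis by (simp add: assms(2))
qed

text \<open>\<open>bound_powq\<close> evaluates the power at the end where it is smallest: at
  \<open>h\<close> for negative and at \<open>g\<close> for positive exponents.\<close>

lemma bound_powq_le:
  fixes g h x :: "'a::linordered_radicable_semifield"
  assumes "x \<noteq> 0" "g \<le> x" "x \<le> h"
  shows "bound_powq g h p \<le> x powq p"
proof -
  have "h \<noteq> 0" using assms by (auto dest: antisym)
  moreover have "g \<le> h" using assms by simp
  ultimately show ?thesis
    using assms by (auto simp: bound_powq_eq intro: powq_antimono powq_mono)
qed

theorem proposition1:
  fixes M :: nat
    and p :: "nat \<Rightarrow> rat"
    and a :: "nat \<Rightarrow> 'a::linordered_radicable_semifield"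
    and g h \<mu> :: 'a
    and f :: "'a \<Rightarrow> 'a"
    and S :: "'a set"
  assumes a_nonzero: "\<And>i. i \<in> {1..M} \<Longrightarrow> a i \<noteq> 0"
    and h_nonzero: "h \<noteq> 0"
    and g_le_h: "g \<le> h"
    (* Otherwise \<mu> = 0 and the negative powers of \<mu> in the upper bound are undefined. *)
    and powers_defined: "g = 0 \<Longrightarrow> \<exists>i\<in>{1..M}. 0 < p i \<Longrightarrow> \<exists>i\<in>{1..M}. p i \<le> 0"
    and objective: "f = (\<lambda>x. \<Sum>i\<in>{1..M}. a i * x powq (p i))"
    and feasible: "S = {x. x \<noteq> 0 \<and> g \<le> x \<and> x \<le> h}"
    and \<mu>: "\<mu> =
      (\<Sum>(i, k)\<in>{(i, k). i \<in> {1..M} \<and> k \<in> {1..M} \<and> p i < 0 \<and> 0 < p k}.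
          a i powq (- p k / (p i - p k)) * a k powq (p i / (p i - p k)))
      + (\<Sum>i\<in>{1..M}. bound_powq g h (p i) * a i)"
  shows "(\<exists>x\<in>S. f x = \<mu>) \<and> (\<forall>x\<in>S. \<mu> \<le> f x) \<and>
    (\<forall>x. is_arg_min f (\<lambda>x. x \<in> S) x \<longleftrightarrow>
      x \<noteq> 0 \<and>
      (\<Sum>i\<in>{i\<in>{1..M}. p i < 0}. \<mu> powq (1 / p i) * a i powq (- 1 / p i)) + g \<le> x \<and>
      x \<le> inverse ((\<Sum>i\<in>{i\<in>{1..M}. 0 < p i}. \<mu> powq (- 1 / p i) * a i powq (1 / p i))
                   + inverse h))"
proof -
  define mix where "mix i k = a i powq (- p k / (p i - p k)) * a k powq (p i / (p i - p k))" for i k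
  define l where "l i = \<mu> powq (1 / p i) * a i powq (- 1 / p i)" for i
  define u where "u i = \<mu> powq (- 1 / p i) * a i powq (1 / p i)" for i
  let ?P = "{(i, k). i \<in> {1..M} \<and> k \<in> {1..M} \<and> p i < 0 \<and> 0 < p k}"
  let ?N = "{i\<in>{1..M}. p i < 0}" and ?Q = "{i\<in>{1..M}. 0 < p i}"
  define L where "L = sum l ?N + g"
  define V where "V = sum u ?Q + inverse h"
  have finP: "finite ?P"
    by (rule finite_subset[of _ "{1..M} \<times> {1..M}"]) auto
  have \<mu>_le_iff: "\<mu> \<le> z \<longleftrightarrow> (\<forall>(i, k)\<in>?P. mix i k \<le> z) \<and>
      (\<forall>i\<in>{1..M}. bound_powq g h (p i) * a i \<le> z)" for z
    unfolding \<mu> mix_def semifield_add_le_iff semifield_sum_le_iff[OF finP]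
      semifield_sum_le_iff[OF finite_atLeastAtMost] by auto
  have mix_le: "mix i k \<le> \<mu>" if "i \<in> ?N" "k \<in> ?Q" for i k
    using \<mu>_le_iff[of \<mu>] that by auto
  have bound_le: "bound_powq g h (p i) * a i \<le> \<mu>" if "i \<in> {1..M}" for i
    using \<mu>_le_iff[of \<mu>] that by auto
  have f_le_iff: "f x \<le> z \<longleftrightarrow> (\<forall>i\<in>{1..M}. a i * x powq p i \<le> z)" for x z
    unfolding objective by (simp add: semifield_sum_le_iff)

  \<comment> \<open>Positive weights make the powers monotone, the vanishing combination removes
    \<open>x\<close>, and the sum 1 lets two powers of a common bound multiply to that
    bound.\<close>
  have weights: "0 < - r / (q - r)" "0 < q / (q - r)"
    "q * (- r / (q - r)) + r * (q / (q - r)) = 0" "- r / (q - r) + q / (q - r) = 1"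
    if "q < 0" "0 < r" for q r :: rat
    using that by (auto simp: divide_simps)

  have lower: "\<mu> \<le> f x" if "x \<in> S" for x
  proof -
    have x: "x \<noteq> 0" "g \<le> x" "x \<le> h" using that by (auto simp: feasible)
    have term_le: "a i * x powq p i \<le> f x" if "i \<in> {1..M}" for i
      using f_le_iff[of x "f x"] that by blast
    have "mix i k \<le> f x" if ik: "i \<in> ?N" "k \<in> ?Q" for i k
    proof -
      have pik: "p i < 0" "0 < p k" using ik by auto
      note w = weights[OF pik]
      have "a i * x powq p i \<noteq> 0"
        using a_nonzero[of i] ik x(1) by (simp add: semifield_mult_eq_0_iff powq_nonzero)
      then have fx: "f x \<noteq> 0" using term_le[of i] ik by (auto dest: antisym)
      \<comment> \<open>Inserting the cancelling powers of \<open>x\<close> turns both bases into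
        terms of the objective, each at most \<open>f x\<close>.\<close>
      have "mix i k = (a i * x powq p i) powq (- p k / (p i - p k))
          * (a k * x powq p k) powq (p i / (p i - p k))"
        unfolding mix_def by (rule weighted_powq_cancel[symmetric]) (use x w in auto)
      also have "\<dots> \<le> f x powq (- p k / (p i - p k)) * f x powq (p i / (p i - p k))"
        using ik w by (intro semifield_mult_mono powq_mono term_le) auto
      also have "\<dots> = f x" by (simp only: powq_add[OF fx, symmetric] w(4) powq_1_right)
      finally show ?thesis .
    qed
    moreover have "bound_powq g h (p i) * a i \<le> f x" if "i \<in> {1..M}" for i
      using semifield_mult_mono[OF bound_powq_le[OF x] order_refl, of "p i" "a i"] term_le[OF that]
      by (simp add: mult.commute)
    ultimately show ?thesis by (auto simp: \<mu>_le_iff)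
  qed

  \<comment> \<open>If \<open>\<mu>\<close> were 0, every bound term would vanish, forcing
    \<open>g = 0\<close> and only positive exponents, against \<open>powers_defined\<close>. For
    \<open>M = 0\<close> the value \<open>\<mu>\<close> is 0, but no power of it occurs.\<close>
  have \<mu>_nonzero: "\<mu> \<noteq> 0" if M: "1 \<le> M"
  proof
    assume "\<mu> = 0"
    then have "bound_powq g h (p i) * a i = 0" if "i \<in> {1..M}" for i
      using bound_le[OF that] by (auto intro: antisym)
    then have "bound_powq g h (p i) = 0" if "i \<in> {1..M}" for i
      using that a_nonzero[OF that] by (auto simp: semifield_mult_eq_0_iff)
    then have "(if p i < 0 then h powq p i else if p i = 0 then 1 else g powq p i) = 0"
      if "i \<in> {1..M}" for i
      using that by (simp only: bound_powq_eq[OF h_nonzero g_le_h])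
    then have pos: "0 < p i" and g: "g = 0" if "i \<in> {1..M}" for i
      using that powq_nonzero[OF h_nonzero] powq_nonzero[of g]
      by (fastforce split: if_splits)+
    have "1 \<in> {1..M}" using M by simp
    with powers_defined pos g obtain i where "i \<in> {1..M}" "p i \<le> 0" by blast
    with pos show False by force
  qed

  have V: "V \<noteq> 0"
  proof
    assume "V = 0"
    then have "inverse h \<le> 0"
      using semifield_add_le_iff[of "sum u ?Q" "inverse h" V] by (simp add: V_def)
    then show False using semifield_inverse_nonzero[OF h_nonzero] by (auto dest: antisym)
  qed

  \<comment> \<open>The interval is the set of feasible points with \<open>f x \<le> \<mu>\<close>:
    the summands \<open>g\<close> and \<open>inverse h\<close> encode feasibility, the others the
    single terms of the objective.\<close>
  have sol_iff: "x \<noteq> 0 \<and> L \<le> x \<and> x \<le> inverse V \<longleftrightarrow> x \<in> S \<and> f x \<le> \<mu>" for x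
  proof (cases "x = 0")
    case False
    \<comment> \<open>Terms with exponent 0 do not restrict \<open>x\<close>; they stay below
      \<open>\<mu>\<close> because their bound factor is 1.\<close>
    have zero_term: "a i \<le> \<mu>" if "i \<in> {1..M}" "p i = 0" for i
      using bound_le[OF that(1)] that(2) by (simp add: bound_powq_eq[OF h_nonzero g_le_h])
    have term_iff: "a i * x powq p i \<le> \<mu> \<longleftrightarrow>
        (p i < 0 \<longrightarrow> l i \<le> x) \<and> (0 < p i \<longrightarrow> u i \<le> inverse x)" if "i \<in> {1..M}" for i
    proof -
      have "\<mu> \<noteq> 0" using \<mu>_nonzero that by simp
      then show ?thesis
        using mult_powq_le_iff_neg[OF a_nonzero[OF that] _ False, of \<mu> "p i"]
          mult_powq_le_iff_pos[OF a_nonzero[OF that] _ False, of \<mu> "p i"] zero_term[OF that]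
        unfolding l_def u_def by (cases "p i" "0::rat" rule: linorder_cases) auto
    qed
    have "L \<le> x \<longleftrightarrow> (\<forall>i\<in>?N. l i \<le> x) \<and> g \<le> x"
      by (simp add: L_def semifield_add_le_iff semifield_sum_le_iff)
    moreover have "x \<le> inverse V \<longleftrightarrow> (\<forall>i\<in>?Q. u i \<le> inverse x) \<and> x \<le> h"
      using semifield_le_inverse_iff[OF False V] semifield_inverse_le_inverse_iff[OF h_nonzero False]
      by (simp add: V_def semifield_add_le_iff semifield_sum_le_iff)
    moreover have "f x \<le> \<mu> \<longleftrightarrow> (\<forall>i\<in>?N. l i \<le> x) \<and> (\<forall>i\<in>?Q. u i \<le> inverse x)"
      unfolding f_le_iff using term_iff by auto
    ultimately show ?thesis using False by (auto simp: feasible)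
  qed (simp add: feasible)

  define x where "x = inverse V"
  have x: "x \<noteq> 0" by (simp add: x_def semifield_inverse_nonzero V)
  have "L \<le> x"
  proof -
    \<comment> \<open>By linearity \<open>V\<close> equals one of its summands, which yields the two
      cases for the upper end.\<close>
    have "V = inverse h \<or> V = sum u ?Q"
      unfolding V_def by (metis le_iff_add_eq linear add.commute)
    then consider (h) "x = h" | (k) k where "k \<in> ?Q" "V = u k"
      using semifield_sum_attained[of ?Q u] V by (auto simp: x_def)
    then have "g \<le> x \<and> (\<forall>i\<in>?N. l i \<le> x)"
    proof cases
      case h
      \<comment> \<open>For a negative exponent the bound term is the value of the
        \<open>i\<close>-th term at \<open>h\<close>.\<close>
      have "l i \<le> h" if i: "i \<in> ?N" for i
      proof -
        have "a i * h powq p i \<le> \<mu>"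
          using bound_le[of i] i by (simp add: bound_powq_eq[OF h_nonzero g_le_h] mult.commute)
        then show ?thesis
          using mult_powq_le_iff_neg[of "a i" \<mu> h "p i"] a_nonzero[of i] \<mu>_nonzero h_nonzero i
          by (simp add: l_def)
      qed
      with h g_le_h show ?thesis by simp
    next
      case k
      have pk: "k \<in> {1..M}" "0 < p k" and ak: "a k \<noteq> 0" and m: "\<mu> \<noteq> 0"
        using k(1) a_nonzero[of k] \<mu>_nonzero by auto
      have eq: "a k * x powq p k = \<mu>"
        by (rule mult_powq_eq_pos[OF ak m pk(2)]) (simp add: x_def k(2) u_def)
      \<comment> \<open>For nonzero \<open>g\<close>, the bound term of index \<open>k\<close> is
        \<open>a k * g powq p k\<close>, hence at most \<open>\<mu>\<close>, which is the
        \<open>k\<close>-th term at \<open>x\<close>.\<close>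
      have "g \<le> x"
      proof (cases "g = 0")
        case False
        have "a k * g powq p k \<le> a k * x powq p k"
          using bound_le[OF pk(1)] pk(2)
          by (simp add: eq bound_powq_eq[OF h_nonzero g_le_h] mult.commute)
        then have "g powq p k \<le> x powq p k"
          using semifield_mult_le_cancel[OF ak] by (metis mult.commute)
        then show ?thesis using powq_le_iff[OF pk(2) False x] by simp
      qed simp
      moreover have "l i \<le> x" if i: "i \<in> ?N" for i
      proof -
        have pi: "p i < 0" and ai: "a i \<noteq> 0" using i a_nonzero by auto
        note w = weights[OF pi pk(2)]
        let ?s = "- p k / (p i - p k)" and ?t = "p i / (p i - p k)"
        \<comment> \<open>Since the \<open>k\<close>-th term equals \<open>\<mu>\<close>, the bound
          on \<open>mix i k\<close> concerns the \<open>i\<close>-th term alone: cancelling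
          \<open>\<mu> powq ?t\<close> and then the positive exponent \<open>?s\<close> leaves that
          term below \<open>\<mu>\<close>.\<close>
        have "(a i * x powq p i) powq ?s * \<mu> powq ?t = mix i k"
          unfolding mix_def using weighted_powq_cancel[OF x w(3), of "a i" "a k"] eq by simp
        also have "\<dots> \<le> \<mu>" using mix_le i k(1) by blast
        also have "\<mu> = \<mu> powq ?s * \<mu> powq ?t"
          by (simp only: powq_add[OF m, symmetric] w(4) powq_1_right)
        finally have "(a i * x powq p i) powq ?s \<le> \<mu> powq ?s"
          using semifield_mult_le_cancel[OF powq_nonzero[OF m]] by blast
        moreover have "a i * x powq p i \<noteq> 0"
          using ai x by (simp add: semifield_mult_eq_0_iff powq_nonzero)
        ultimately have "a i * x powq p i \<le> \<mu>"
          using powq_le_iff[OF w(1) _ m] by blast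
        then show ?thesis
          using mult_powq_le_iff_neg[OF ai m x pi] by (simp add: l_def)
      qed
      ultimately show ?thesis by blast
    qed
    then show ?thesis by (simp add: L_def semifield_add_le_iff semifield_sum_le_iff)
  qed
  then have x_sol: "x \<in> S" "f x = \<mu>"
    using sol_iff[of x] x lower by (auto simp: x_def intro: antisym)
  \<comment> \<open>As \<open>\<mu>\<close> is attained and is a lower bound, minimality amounts to
    \<open>f y \<le> \<mu>\<close>.\<close>
  have "is_arg_min f (\<lambda>x. x \<in> S) y \<longleftrightarrow> y \<in> S \<and> f y \<le> \<mu>" for y
    using x_sol lower unfolding is_arg_min_def by (metis not_le order_trans)
  then have "\<forall>y. is_arg_min f (\<lambda>x. x \<in> S) y \<longleftrightarrow> y \<noteq> 0 \<and> L \<le> y \<and> y \<le> inverse V"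
    using sol_iff by blast
  then show ?thesis
    using x_sol lower unfolding L_def V_def l_def u_def by blast
qed

end
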